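(* If $G$ and $H$ are connected graphs, then $\mu_{\rm t}(G\,\square\,H)=0$ if and only if $\mu_{\rm t}(G)=0$ or $\mu_{\rm t}(H)=0$.
   Context: All graphs are finite, simple and connected. The Cartesian product $G\,\square\,H$ has vertex set $V(G)\times V(H)$, with $(g,h)$ adjacent to $(g',h')$ iff either $gg'\in E(G)$ and $h=h'$, or $g=g'$ and $hh'\in E(H)$. For $X\subseteq V(G)$, two vertices $x,y$ are $X$-visible if there is a shortest $x,y$-path $P$ with $V(P)\cap X\subseteq\{x,y\}$; $X$ is a total mutual-visibility set if every pair of vertices of $G$ is $X$-visible. $\mu_{\rm t}(G)$ is the largest cardinality of a total mutual-visibility set of $G$. *)

theory Defs
  imports
    "Graph_Theory.Digraph_Component"
    "Graph_Theory.Vertex_Walk"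
begin

text \<open>
  Finite simple graphs are the \<^locale>\<open>pair_graph\<close>s of the library: finite, symmetric,
  loop-free sets of vertex pairs. The library's \<^const>\<open>connected\<close> includes that the vertex set is
  nonempty. Paths are duplicate-free lists of vertices (\<^const>\<open>vpath\<close>), so \<open>set p\<close> is the
  vertex set of the path \<open>p\<close>.
\<close>

definition cartesian_product ::
  "'a pair_pre_digraph \<Rightarrow> 'b pair_pre_digraph \<Rightarrow> ('a \<times> 'b) pair_pre_digraph" (infixr "\<box>" 70)
where
  "G \<box> H = \<lparr> pverts = pverts G \<times> pverts H,
     parcs = {((g, h), (g', h')) | g h g' h'.
       (g, h) \<in> pverts G \<times> pverts H \<and> (g', h') \<in> pverts G \<times> pverts H \<and>
       ((g, g') \<in> parcs G \<and> h = h' \<or> g = g' \<and> (h, h') \<in> parcs H)} \<rparr>"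

definition path_between :: "'a pair_pre_digraph \<Rightarrow> 'a \<Rightarrow> 'a list \<Rightarrow> 'a \<Rightarrow> bool" where
  "path_between G x p y \<longleftrightarrow> vpath p (with_proj G) \<and> hd p = x \<and> last p = y"

definition shortest_path_between :: "'a pair_pre_digraph \<Rightarrow> 'a \<Rightarrow> 'a list \<Rightarrow> 'a \<Rightarrow> bool" where
  "shortest_path_between G x p y \<longleftrightarrow> path_between G x p y \<and>
     (\<forall>q. path_between G x q y \<longrightarrow> vwalk_length p \<le> vwalk_length q)"

definition visible :: "'a pair_pre_digraph \<Rightarrow> 'a set \<Rightarrow> 'a \<Rightarrow> 'a \<Rightarrow> bool" where
  "visible G X x y \<longleftrightarrow> (\<exists>p. shortest_path_between G x p y \<and> set p \<inter> X \<subseteq> {x, y})"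

definition total_mutual_visibility_set :: "'a pair_pre_digraph \<Rightarrow> 'a set \<Rightarrow> bool" where
  "total_mutual_visibility_set G X \<longleftrightarrow>
     X \<subseteq> pverts G \<and> (\<forall>x\<in>pverts G. \<forall>y\<in>pverts G. visible G X x y)"

definition total_mutual_visibility_number :: "'a pair_pre_digraph \<Rightarrow> nat" ("\<mu>\<^sub>t") where
  "\<mu>\<^sub>t G = Max (card ` {X. total_mutual_visibility_set G X})"

text \<open>
  For a connected finite graph the maximum in the last definition is taken over a finite nonempty
  set, so it is a genuine maximum.
\<close>

lemma finite_total_mutual_visibility_sets:
  assumes "pair_graph G"
  shows "finite {X. total_mutual_visibility_set G X}"
proof -
  interpret pair_graph G by fact
  have "{X. total_mutual_visibility_set G X} \<subseteq> Pow (pverts G)"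
    by (auto simp: total_mutual_visibility_set_def)
  then show ?thesis
    using pair_finite_verts by (meson finite_Pow_iff finite_subset)
qed

lemma total_mutual_visibility_set_empty:
  assumes "pair_graph G" and "connected (with_proj G)"
  shows "total_mutual_visibility_set G {}"
proof -
  interpret pair_graph G by fact
  have "visible G {} x y" if xy: "x \<in> pverts G" "y \<in> pverts G" for x y
  proof -
    have "x \<rightarrow>\<^sup>*\<^bsub>with_proj G\<^esub> y"
      using assms(2) xy reachable_mk_symmetric_eq[OF pair_sym_arcs]
      by (auto simp: connected_def strongly_connected_def)
    then obtain q where "vpath q (with_proj G)" "hd q = x" "last q = y"
      by (metis reachable_vpath_conv)
    then have "\<exists>q. path_between G x q y"
      by (auto simp: path_between_def)
    then obtain p where "path_between G x p y"
      "\<And>q. path_between G x q y \<Longrightarrow> vwalk_length p \<le> vwalk_length q"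
      using ex_has_least_nat[of "\<lambda>q. path_between G x q y" _ vwalk_length] by metis
    then show ?thesis
      by (auto simp: visible_def shortest_path_between_def)
  qed
  then show ?thesis
    by (simp add: total_mutual_visibility_set_def)
qed

lemma pair_graph_cartesian_product:
  assumes "pair_graph G" and "pair_graph H"
  shows "pair_graph (G \<box> H)"
proof -
  interpret G: pair_graph G by fact
  interpret H: pair_graph H by fact
  have fin: "finite (pverts (G \<box> H))"
    by (simp add: cartesian_product_def G.pair_finite_verts H.pair_finite_verts)
  have sub: "parcs (G \<box> H) \<subseteq> pverts (G \<box> H) \<times> pverts (G \<box> H)"
    by (auto simp: cartesian_product_def)
  have "sym (parcs G)" "sym (parcs H)"
    using G.pair_sym_arcs H.pair_sym_arcs by (simp_all add: symmetric_def)
  then have "sym (parcs (G \<box> H))"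
    by (fastforce simp: cartesian_product_def sym_def)
  moreover have "fst e \<noteq> snd e" if "e \<in> parcs (G \<box> H)" for e
    using that G.pair_no_loops H.pair_no_loops by (fastforce simp: cartesian_product_def)
  moreover have "finite (parcs (G \<box> H))"
    using sub fin by (meson finite_SigmaI finite_subset)
  ultimately show ?thesis
    using fin sub by unfold_locales (auto simp: symmetric_def)
qed

end

theory Submission
  imports Defs
begin

text \<open>
  Total mutual-visibility sets are closed under taking subsets, so \<open>\<mu>\<^sub>t G \<noteq> 0\<close> iff some singleton
  \<open>{v}\<close> is one. Rerouting a shortest path around \<open>v\<close> shows that this is a local condition:
  any two distinct nonadjacent neighbours of \<open>v\<close> have a common neighbour other than \<open>v\<close>. In the
  Cartesian product, neighbours of \<open>(g, h)\<close> in different directions always have a second common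
  neighbour, so the condition holds at \<open>(g, h)\<close> iff it holds at \<open>g\<close> and at \<open>h\<close>.
\<close>

text \<open>The arcs run along the walks \<open>[x, v, y]\<close> and \<open>[x, w, y]\<close>, so
  \<open>w\<close> can take the place of \<open>v\<close> in a vertex list directly. The condition
  is vacuous when the neighbours of \<open>v\<close> are pairwise adjacent.\<close>

definition bypass_vertex :: "'a pair_pre_digraph \<Rightarrow> 'a \<Rightarrow> bool" where
  "bypass_vertex G v \<longleftrightarrow> v \<in> pverts G \<and>
     (\<forall>x y. (x, v) \<in> parcs G \<longrightarrow> (v, y) \<in> parcs G \<longrightarrow> x \<noteq> y \<longrightarrow> (x, y) \<notin> parcs G \<longrightarrow>
       (\<exists>w. w \<noteq> v \<and> (x, w) \<in> parcs G \<and> (w, y) \<in> parcs G))"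

lemma bypass_vertexE:
  assumes "bypass_vertex G v" "(x, v) \<in> parcs G" "(v, y) \<in> parcs G" "x \<noteq> y" "(x, y) \<notin> parcs G"
  obtains w where "w \<noteq> v" "(x, w) \<in> parcs G" "(w, y) \<in> parcs G"
  using assms unfolding bypass_vertex_def by meson

section \<open>Walks and shortest paths as vertex lists\<close>

lemma vwalk_append_iff:
  assumes "p \<noteq> []" "q \<noteq> []"
  shows "vwalk (p @ q) G \<longleftrightarrow> vwalk p G \<and> vwalk q G \<and> (last p, hd q) \<in> arcs_ends G"
  using assms by (auto simp: vwalk_def vwalk_arcs_append)

lemma length_vwalk_to_vpath_le: "length (vwalk_to_vpath p) \<le> length p"
proof (induct p rule: vwalk_to_vpath_induct3)
  case (in_set x xs)
  then show ?case
    using length_dropWhile_le[of "\<lambda>y. y \<noteq> x" xs] by simp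
qed auto

text \<open>At the first vertex that occurs again, \<open>vwalk_to_vpath\<close> jumps to its next
  occurrence, which discards at least one entry; the rest never grows.\<close>

lemma length_vwalk_to_vpath_less:
  "\<not> distinct p \<Longrightarrow> length (vwalk_to_vpath p) < length p"
proof (induct p rule: vwalk_to_vpath_induct3)
  case (in_set x xs)
  then show ?case
    using length_vwalk_to_vpath_le[of "dropWhile (\<lambda>y. y \<noteq> x) xs"]
      length_dropWhile_le[of "\<lambda>y. y \<noteq> x" xs] by simp
qed auto

text \<open>Minimality compares \<open>p\<close> with paths only, so the walk \<open>q\<close>
  competes after its closed pieces are cut out. The bound keeps \<open>vwalk_to_vpath q\<close>
  instead of \<open>q\<close> because it is strictly shorter when \<open>q\<close> repeats a
  vertex.\<close>

lemma shortest_path_length_le: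
  assumes p: "shortest_path_between G x p y"
    and q: "vwalk q (with_proj G)" "hd q = x" "last q = y"
  shows "length p \<le> length (vwalk_to_vpath q)"
proof -
  have "path_between G x (vwalk_to_vpath q) y"
    using q by (simp add: path_between_def vwalk_to_vpath_hd vwalk_to_vpath_last
        vwalk_to_vpath_vpath)
  \<comment> \<open>\<open>vwalk_length\<close> is the number of vertices minus one, truncated at 0;
    nonemptiness makes comparing arcs the same as comparing vertices.\<close>
  moreover have "vwalk_to_vpath q \<noteq> []" "p \<noteq> []"
    using p q
    by (auto simp: vwalk_to_vpath_nonempty vwalk_def shortest_path_between_def path_between_def
        vpath_def)
  ultimately show ?thesis
    using p by (cases p; cases "vwalk_to_vpath q") (auto simp: shortest_path_between_def)
qed

text \<open>A repeated vertex in \<open>q\<close> could be cut out, leaving a path shorter than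
  \<open>p\<close>. Distinctness of a rerouted walk therefore comes for free from its
  length.\<close>

lemma shortest_path_between_vwalk:
  assumes p: "shortest_path_between G x p y"
    and q: "vwalk q (with_proj G)" "hd q = x" "last q = y" and len: "length q = length p"
  shows "shortest_path_between G x q y"
proof -
  have "distinct q"
    using shortest_path_length_le[OF p q] length_vwalk_to_vpath_less[of q] len by linarith
  then show ?thesis
    using p q len by (auto simp: shortest_path_between_def path_between_def vpath_def)
qed

section \<open>Visibility past one vertex as a local condition\<close>

lemma ex_shortest_path_between:
  assumes "pair_graph G" and "connected (with_proj G)" and "x \<in> pverts G" "y \<in> pverts G"
  shows "\<exists>p. shortest_path_between G x p y"
  using total_mutual_visibility_set_empty[OF assms(1,2)] assms(3,4)
  by (auto simp: total_mutual_visibility_set_def visible_def)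

lemma visible_bypass_vertex:
  assumes G: "pair_graph G" "connected (with_proj G)" and v: "bypass_vertex G v"
    and xy: "x \<in> pverts G" "y \<in> pverts G"
  shows "visible G {v} x y"
proof -
  interpret pair_graph G by fact
  obtain p where p: "shortest_path_between G x p y"
    using ex_shortest_path_between[OF G xy] by blast
  then have vw: "vwalk p (with_proj G)" and hd: "hd p = x" and last: "last p = y" and "distinct p"
    by (auto simp: shortest_path_between_def path_between_def vpath_def)
  show ?thesis
  \<comment> \<open>Only an inner occurrence of \<open>v\<close> obstructs visibility; it then has a
    predecessor \<open>a\<close> and a successor \<open>b\<close> on \<open>p\<close>.\<close>
  proof (cases "v \<in> set p \<and> v \<noteq> x \<and> v \<noteq> y")
    case False
    then show ?thesis using p by (auto simp: visible_def)
  next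
    case True
    then obtain r s where rs: "p = r @ v # s" by (meson split_list)
    have "r \<noteq> []" using rs hd True by auto
    then obtain p1 a where r: "r = p1 @ [a]" by (metis rev_exhaust)
    have "s \<noteq> []" using rs last True by auto
    then obtain b p2 where s: "s = b # p2" by (metis list.exhaust)
    have p_eq: "p = (p1 @ [a]) @ v # b # p2" using rs r s by simp
    have av: "(a, v) \<in> parcs G" and vb: "(v, b) \<in> parcs G"
      and w1: "vwalk (p1 @ [a]) (with_proj G)" and w2: "vwalk (b # p2) (with_proj G)"
      using vw vwalk_append_iff[of "p1 @ [a]" "v # b # p2" "with_proj G"]
      by (simp_all add: p_eq)
    have "a \<noteq> b" using \<open>distinct p\<close> p_eq by auto
    \<comment> \<open>Otherwise skipping \<open>v\<close> would give a walk with one vertex fewer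
      than the shortest path.\<close>
    have "(a, b) \<notin> parcs G"
    proof
      assume "(a, b) \<in> parcs G"
      then have "vwalk ((p1 @ [a]) @ b # p2) (with_proj G)"
        using w1 w2 by (subst vwalk_append_iff) auto
      from shortest_path_length_le[OF p this] length_vwalk_to_vpath_le[of "(p1 @ [a]) @ b # p2"]
      show False
        using hd last by (cases p1) (auto simp: p_eq)
    qed
    then obtain w where w: "w \<noteq> v" "(a, w) \<in> parcs G" "(w, b) \<in> parcs G"
      using bypass_vertexE[OF v av vb \<open>a \<noteq> b\<close>] by blast
    let ?q = "(p1 @ [a]) @ w # b # p2"
    have "vwalk (w # b # p2) (with_proj G)" using w w2 by simp
    then have "vwalk ?q (with_proj G)" using w w1 by (subst vwalk_append_iff) auto
    \<comment> \<open>Swapping \<open>v\<close> for \<open>w\<close> keeps the number of vertices,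
      so this is a path even though \<open>w\<close> might a priori already lie on
      \<open>p\<close>.\<close>
    then have "shortest_path_between G x ?q y"
      using hd last by (intro shortest_path_between_vwalk[OF p]) (cases p1; auto simp: p_eq)+
    moreover have "v \<notin> set ?q" using \<open>distinct p\<close> w(1) by (auto simp: p_eq)
    ultimately show ?thesis by (auto simp: visible_def)
  qed
qed

text \<open>Two distinct nonadjacent neighbours of \<open>v\<close> are at distance 2, so the inner
  vertex of a shortest path avoiding \<open>v\<close> is the required second common
  neighbour.\<close>

lemma bypass_vertex_if_total_mutual_visibility_set:
  assumes G: "pair_graph G" and v: "total_mutual_visibility_set G {v}"
  shows "bypass_vertex G v"
proof -
  interpret pair_graph G by fact
  have "\<exists>w. w \<noteq> v \<and> (x, w) \<in> parcs G \<and> (w, y) \<in> parcs G"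
    if xv: "(x, v) \<in> parcs G" and vy: "(v, y) \<in> parcs G" and "x \<noteq> y" and nadj: "(x, y) \<notin> parcs G"
    for x y
  proof -
    have verts: "x \<in> pverts G" "v \<in> pverts G" "y \<in> pverts G"
      using xv vy by (auto dest: wellformed')
    then obtain p where p: "shortest_path_between G x p y" and vis: "set p \<inter> {v} \<subseteq> {x, y}"
      using v unfolding total_mutual_visibility_set_def visible_def by meson
    have "v \<noteq> x" "v \<noteq> y" using xv vy pair_no_loops by force+
    with vis have "v \<notin> set p" by auto
    have "vwalk [x, v, y] (with_proj G)" using xv vy verts by simp
    from shortest_path_length_le[OF p this] length_vwalk_to_vpath_le[of "[x, v, y]"]
    have "length p \<le> 3" by simp
    moreover have vw: "vwalk p (with_proj G)" "hd p = x" "last p = y"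
      using p by (auto simp: shortest_path_between_def path_between_def vpath_def)
    \<comment> \<open>The first three cases contradict, in turn, that \<open>p\<close> is a walk,
      that \<open>x\<close> and \<open>y\<close> differ, and that they are nonadjacent.\<close>
    ultimately consider "p = []" | "p = [x]" "x = y" | "p = [x, y]" | w where "p = [x, w, y]"
      by (cases p; cases "tl p"; cases "tl (tl p)"; cases "tl (tl (tl p))") auto
    then show ?thesis
      using vw nadj \<open>x \<noteq> y\<close> \<open>v \<notin> set p\<close> by cases auto
  qed
  then show ?thesis
    using v by (auto simp: bypass_vertex_def total_mutual_visibility_set_def)
qed

lemma total_mutual_visibility_set_singleton_iff:
  assumes "pair_graph G" and "connected (with_proj G)"
  shows "total_mutual_visibility_set G {v} \<longleftrightarrow> bypass_vertex G v"
  using bypass_vertex_if_total_mutual_visibility_set[OF assms(1)] visible_bypass_vertex[OF assms]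
  by (auto simp: total_mutual_visibility_set_def bypass_vertex_def)

section \<open>From singletons to the number \<open>\<mu>\<^sub>t\<close>\<close>

lemma total_mutual_visibility_set_mono:
  assumes "total_mutual_visibility_set G X" "Y \<subseteq> X"
  shows "total_mutual_visibility_set G Y"
  using assms unfolding total_mutual_visibility_set_def visible_def by blast

lemma total_mutual_visibility_number_eq_0_iff:
  assumes "pair_graph G" and "connected (with_proj G)"
  shows "\<mu>\<^sub>t G = 0 \<longleftrightarrow> (\<nexists>v. bypass_vertex G v)"
proof -
  interpret pair_graph G by fact
  let ?S = "{X. total_mutual_visibility_set G X}"
  have "finite ?S" "?S \<noteq> {}"
    using finite_total_mutual_visibility_sets[OF assms(1)] total_mutual_visibility_set_empty[OF assms]
    by auto
  then have "\<mu>\<^sub>t G = 0 \<longleftrightarrow> (\<forall>X\<in>?S. card X = 0)"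
    unfolding total_mutual_visibility_number_def
    by (subst Max_eq_iff) auto
  also have "\<dots> \<longleftrightarrow> (\<forall>X\<in>?S. X = {})"
  proof -
    \<comment> \<open>Finiteness matters because \<open>card\<close> is also 0 on infinite
      sets.\<close>
    have "finite X" if "X \<in> ?S" for X
      using that pair_finite_verts by (auto simp: total_mutual_visibility_set_def intro: finite_subset)
    then show ?thesis by auto
  qed
  also have "\<dots> \<longleftrightarrow> (\<nexists>v. total_mutual_visibility_set G {v})"
    using total_mutual_visibility_set_mono[of G] by blast
  finally show ?thesis
    by (simp add: total_mutual_visibility_set_singleton_iff[OF assms])
qed

section \<open>The local condition and connectedness in the Cartesian product\<close>

lemma bypass_vertex_cartesian_product_iff:
  assumes "pair_graph G" and "pair_graph H"
  shows "bypass_vertex (G \<box> H) (g, h) \<longleftrightarrow> bypass_vertex G g \<and> bypass_vertex H h"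
proof -
  interpret G: pair_graph G by fact
  interpret H: pair_graph H by fact
  have noloop: "(a, a) \<notin> parcs G" "(b, b) \<notin> parcs H" for a b
    using G.pair_no_loops H.pair_no_loops by force+
  have arc: "((a, b), (a', b')) \<in> parcs (G \<box> H) \<longleftrightarrow>
      (a, a') \<in> parcs G \<and> b = b' \<and> b \<in> pverts H \<or> a = a' \<and> a \<in> pverts G \<and> (b, b') \<in> parcs H"
    for a b a' b'
    by (auto simp: cartesian_product_def dest: G.wellformed' H.wellformed')
  have verts: "pverts (G \<box> H) = pverts G \<times> pverts H"
    by (simp add: cartesian_product_def)
  show ?thesis
  proof
    assume byp: "bypass_vertex (G \<box> H) (g, h)"
    then have gh: "g \<in> pverts G" "h \<in> pverts H"
      by (auto simp: bypass_vertex_def verts)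
    have *: "\<exists>w. w \<noteq> (g, h) \<and> (p, w) \<in> parcs (G \<box> H) \<and> (w, q) \<in> parcs (G \<box> H)"
      if "(p, (g, h)) \<in> parcs (G \<box> H)" "((g, h), q) \<in> parcs (G \<box> H)" "p \<noteq> q"
        "(p, q) \<notin> parcs (G \<box> H)" for p q
      using bypass_vertexE[OF byp that] by blast
    \<comment> \<open>A common neighbour of \<open>(x, h)\<close> and \<open>(y, h)\<close> with
      \<open>x \<noteq> y\<close> stays in the layer of \<open>h\<close>: a single step in direction
      \<open>H\<close> would have to be a loop, and two such steps would force \<open>x = y\<close>.
      Its first coordinate is the witness.\<close>
    have "\<exists>w. w \<noteq> g \<and> (x, w) \<in> parcs G \<and> (w, y) \<in> parcs G"
      if "(x, g) \<in> parcs G" "(g, y) \<in> parcs G" "x \<noteq> y" "(x, y) \<notin> parcs G" for x y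
      using *[of "(x, h)" "(y, h)"] that gh noloop by (auto simp: arc)
    moreover have "\<exists>w. w \<noteq> h \<and> (x, w) \<in> parcs H \<and> (w, y) \<in> parcs H"
      if "(x, h) \<in> parcs H" "(h, y) \<in> parcs H" "x \<noteq> y" "(x, y) \<notin> parcs H" for x y
      using *[of "(g, x)" "(g, y)"] that gh noloop by (auto simp: arc)
    ultimately show "bypass_vertex G g \<and> bypass_vertex H h"
      using gh by (auto simp: bypass_vertex_def)
  next
    assume byp: "bypass_vertex G g \<and> bypass_vertex H h"
    then have gh: "g \<in> pverts G" "h \<in> pverts H"
      by (auto simp: bypass_vertex_def)
    have "\<exists>w. w \<noteq> (g, h) \<and> (p, w) \<in> parcs (G \<box> H) \<and> (w, q) \<in> parcs (G \<box> H)"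
      if p: "(p, (g, h)) \<in> parcs (G \<box> H)" and q: "((g, h), q) \<in> parcs (G \<box> H)" and "p \<noteq> q"
        and nadj: "(p, q) \<notin> parcs (G \<box> H)" for p q
    proof -
      obtain a b c d where pq: "p = (a, b)" "q = (c, d)" by fastforce
      \<comment> \<open>Each of the two neighbours differs from \<open>(g, h)\<close> in exactly one
        coordinate. In the first two cases both lie in one layer and a bypass of the factor is
        lifted to it.\<close>
      from p q consider
          "(a, g) \<in> parcs G" "b = h" "(g, c) \<in> parcs G" "d = h"
        | "a = g" "(b, h) \<in> parcs H" "c = g" "(h, d) \<in> parcs H"
        | "(a, g) \<in> parcs G" "b = h" "c = g" "(h, d) \<in> parcs H"
        | "a = g" "(b, h) \<in> parcs H" "(g, c) \<in> parcs G" "d = h"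
        by (auto simp: pq arc)
      then show ?thesis
      proof cases
        case 1
        then have "a \<noteq> c" "(a, c) \<notin> parcs G"
          using \<open>p \<noteq> q\<close> nadj gh by (auto simp: pq arc)
        then obtain w where "w \<noteq> g" "(a, w) \<in> parcs G" "(w, c) \<in> parcs G"
          using bypass_vertexE[of G g a c] byp 1 by blast
        then show ?thesis
          using 1 gh by (intro exI[of _ "(w, h)"]) (auto simp: pq arc)
      next
        case 2
        then have "b \<noteq> d" "(b, d) \<notin> parcs H"
          using \<open>p \<noteq> q\<close> nadj gh by (auto simp: pq arc)
        then obtain w where "w \<noteq> h" "(b, w) \<in> parcs H" "(w, d) \<in> parcs H"
          using bypass_vertexE[of H h b d] byp 2 by blast
        then show ?thesis
          using 2 gh by (intro exI[of _ "(g, w)"]) (auto simp: pq arc)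
      next
        case 3
        then show ?thesis
          \<comment> \<open>The vertices \<open>(g, h)\<close>, \<open>(a, h)\<close>,
            \<open>(a, d)\<close>, \<open>(g, d)\<close> form a 4-cycle; the witness is the corner
            opposite to \<open>(g, h)\<close>. The last case is symmetric.\<close>
          using noloop by (intro exI[of _ "(a, d)"]) (auto simp: pq arc dest: G.wellformed' H.wellformed')
      next
        case 4
        then show ?thesis
          using noloop by (intro exI[of _ "(c, b)"]) (auto simp: pq arc dest: G.wellformed' H.wellformed')
      qed
    qed
    then show "bypass_vertex (G \<box> H) (g, h)"
      using gh by (auto simp: bypass_vertex_def verts)
  qed
qed

text \<open>This allows the characterisation of \<open>\<mu>\<^sub>t G = 0\<close> to be applied to
  the product. Walks of either factor lift to layers, so the coordinates can be changed one after
  the other.\<close>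

lemma connected_cartesian_product:
  assumes G: "pair_graph G" "connected (with_proj G)" and H: "pair_graph H" "connected (with_proj H)"
  shows "connected (with_proj (G \<box> H))"
proof -
  interpret G: pair_graph G by fact
  interpret H: pair_graph H by fact
  interpret P: pair_graph "G \<box> H" using G(1) H(1) by (rule pair_graph_cartesian_product)
  have verts: "pverts (G \<box> H) = pverts G \<times> pverts H"
    by (simp add: cartesian_product_def)
  have stepG: "(g, h) \<rightarrow>\<^sup>*\<^bsub>with_proj (G \<box> H)\<^esub> (g', h)"
    if "g \<rightarrow>\<^sup>*\<^bsub>with_proj G\<^esub> g'" "h \<in> pverts H" for g g' h
    using that
  proof (induct rule: G.converse_reachable_induct)
    case base
    then show ?case using verts by auto
  next
    case (step x y)
    then have "((x, h), (y, h)) \<in> parcs (G \<box> H)"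
      by (auto simp: cartesian_product_def dest: G.wellformed')
    then show ?case using step by (metis P.adj_reachable_trans)
  qed
  have stepH: "(g, h) \<rightarrow>\<^sup>*\<^bsub>with_proj (G \<box> H)\<^esub> (g, h')"
    if "h \<rightarrow>\<^sup>*\<^bsub>with_proj H\<^esub> h'" "g \<in> pverts G" for g h h'
    using that
  proof (induct rule: H.converse_reachable_induct)
    case base
    then show ?case using verts by auto
  next
    case (step x y)
    then have "((g, x), (g, y)) \<in> parcs (G \<box> H)"
      by (auto simp: cartesian_product_def dest: H.wellformed')
    then show ?case using step by (metis P.adj_reachable_trans)
  qed
  have sc: "strongly_connected (with_proj G)" "strongly_connected (with_proj H)"
    using G.symmetric_connected_imp_strongly_connected[OF G.pair_sym_arcs G(2)]
      H.symmetric_connected_imp_strongly_connected[OF H.pair_sym_arcs H(2)] by auto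
  have "p \<rightarrow>\<^sup>*\<^bsub>with_proj (G \<box> H)\<^esub> q" if "p \<in> pverts (G \<box> H)" "q \<in> pverts (G \<box> H)" for p q
  proof -
    obtain g h g' h' where pq: "p = (g, h)" "q = (g', h')" by (metis surj_pair)
    then have v: "g \<in> pverts G" "h \<in> pverts H" "g' \<in> pverts G" "h' \<in> pverts H"
      using that by (simp_all add: verts)
    then have "g \<rightarrow>\<^sup>*\<^bsub>with_proj G\<^esub> g'" "h \<rightarrow>\<^sup>*\<^bsub>with_proj H\<^esub> h'"
      using sc by (simp_all add: strongly_connected_def)
    then show ?thesis
      unfolding pq using stepG stepH v P.reachable_trans by meson
  qed
  \<comment> \<open>\<open>connected\<close> means strong connectivity of the symmetric closure,
    which has the same reachability when the arcs are already symmetric.\<close>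
  then show ?thesis
    using sc P.reachable_mk_symmetric_eq[OF P.pair_sym_arcs]
    by (simp add: connected_def strongly_connected_def verts)
qed

theorem theorem3p6:
  fixes G :: "'a pair_pre_digraph" and H :: "'b pair_pre_digraph"
  assumes "pair_graph G" and "connected (with_proj G)"
    and "pair_graph H" and "connected (with_proj H)"
  shows "\<mu>\<^sub>t (G \<box> H) = 0 \<longleftrightarrow> \<mu>\<^sub>t G = 0 \<or> \<mu>\<^sub>t H = 0"
  \<comment> \<open>A bypass vertex of the product is a pair of bypass vertices of the factors, so
    one exists iff both factors have one; the claim is the negation of this.\<close>
  using total_mutual_visibility_number_eq_0_iff[OF assms(1,2)]
    total_mutual_visibility_number_eq_0_iff[OF assms(3,4)]
    total_mutual_visibility_number_eq_0_iff[OF pair_graph_cartesian_product[OF assms(1,3)]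
      connected_cartesian_product[OF assms]]
    bypass_vertex_cartesian_product_iff[OF assms(1,3)]
  by auto

end
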